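(* Let the neutral equation \[ \Big[x(t) - \sum_{i=1}^{N_r}R_i(t)x(t - r_i(t)) \Big]' + \sum_{i=1}^{N_p}P_i(t)x(t - \tau_i(t)) - \sum_{i=1}^{N_q}Q_i(t)x(t - \delta_i(t))=0,\quad t\ge t_0, \qquad (\mathrm{N}) \] and the functions $c_i,\bar P_i$ be as in the context. Let $\bar P_i^*(t)$ and $c_i^*(t)$ be arbitrary such that $0\le \bar P_i^*(t)\le \bar P_i(t)$ and $c_i^*(t)\ge c_i(t)$ for all $t\in[t_0+D,\infty)$ and $1\le i\le N_p$. Furthermore, assume that they satisfy \[ \forall\, T_0\in(t_0,\infty)\ \ \exists\, \xi>T_0:\quad \sum_{i=1}^{N_p}\bar P_i^*(\xi)>0, \] and \[ \sum_{i=1}^{N_r}R_i(t)+\sum_{i=1}^{N_q}\int_{t-c_i^*(t)}^{t} Q_i(s)\,ds \le 1 . \] If every solution of \[ x'(t) + \sum_{i=1}^{N_p} \bar P_i^*(t)\, x(t - \tau_i(t)) = 0 \] oscillates, then every solution of (N) also oscillates.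
   Context: Setting. $N_r,N_p,N_q$ are the numbers of terms in the respective sums, with $N_q\le N_p$, and $D\in(0,\infty)$. The functions $R_i,r_i$ ($1\le i\le N_r$), $P_j,\tau_j$ ($1\le j\le N_p$), $Q_k,\delta_k$ ($1\le k\le N_q$) are continuous and nonnegative, $R_i,\tau_j,\delta_k$ are continuously differentiable, and $r_i,\tau_j,\delta_k\le D$ on $[t_0,\infty)$. Moreover $\delta_k(t)\le\tau_k(t)$ and $\delta_k'(t)<1$ for all $1\le k\le N_q$ and $t\in(t_0,\infty)$. Put $Q_i\equiv 0$, $\delta_i\equiv 0$ for $N_q<i\le N_p$. For $1\le i\le N_p$, $c_i$ denotes the unique differentiable function with $c_i(t)=\tau_i(t)-\delta_i(t-c_i(t))$ and $c_i(t)\in[0,D]$ for all $t\ge t_0+D$ (so $c_i=\tau_i$ for $N_q<i\le N_p$). Define $\bar P_i(t)=P_i(t)-Q_i(t-c_i(t))(1-c_i'(t))$ for $t\ge t_0+D$. A solution of (N) is a function continuous on $[t_0-D,\infty)$, continuously differentiable on $(t_0,\infty)$ and satisfying (N) there. A solution of a scalar differential equation oscillates if it has arbitrarily large zeros.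
   Formalization: The functions P̄*_i are assumed continuous rather than arbitrary (the claim fails for discontinuous P̄*_i with classical solutions), and "every solution" of the comparison equation means solutions from every initial time T ≥ t_0+D. *)

theory Defs
  imports "HOL-Analysis.Analysis"
begin

(* At an endpoint belonging to S the derivative is the one-sided one, so C1_on f {a..} does not
   depend on the values of f to the left of a. *)
definition C1_on :: "(real \<Rightarrow> real) \<Rightarrow> real set \<Rightarrow> bool" where
  "C1_on f S \<longleftrightarrow>
     (\<exists>f'. (\<forall>t\<in>S. (f has_real_derivative f' t) (at t within S)) \<and> continuous_on S f')"

definition oscillates :: "(real \<Rightarrow> real) \<Rightarrow> bool" where
  "oscillates x \<longleftrightarrow> (\<forall>T. \<exists>t>T. x t = 0)"

(* The bracket is differentiated as a whole: its summands R i s * x (s - r i s) need not be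
   differentiable separately, since the r i are only assumed continuous. *)
definition neutral_solution ::
  "real \<Rightarrow> real \<Rightarrow> nat \<Rightarrow> nat \<Rightarrow> nat \<Rightarrow>
   (nat \<Rightarrow> real \<Rightarrow> real) \<Rightarrow> (nat \<Rightarrow> real \<Rightarrow> real) \<Rightarrow>
   (nat \<Rightarrow> real \<Rightarrow> real) \<Rightarrow> (nat \<Rightarrow> real \<Rightarrow> real) \<Rightarrow>
   (nat \<Rightarrow> real \<Rightarrow> real) \<Rightarrow> (nat \<Rightarrow> real \<Rightarrow> real) \<Rightarrow>
   (real \<Rightarrow> real) \<Rightarrow> bool" where
  "neutral_solution t0 D Nr Np Nq R r P \<tau> Q \<delta> x \<longleftrightarrow>
     continuous_on {t0 - D..} x \<and>
     C1_on x {t0<..} \<and>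
     (\<forall>t>t0. \<exists>d.
        ((\<lambda>s. x s - (\<Sum>i=1..Nr. R i s * x (s - r i s))) has_real_derivative d) (at t) \<and>
        d + (\<Sum>i=1..Np. P i t * x (t - \<tau> i t)) - (\<Sum>i=1..Nq. Q i t * x (t - \<delta> i t)) = 0)"

(* The initial time T is a parameter because an oscillation hypothesis on a delay equation refers
   to solutions with arbitrary initial time: a solution on {T - D..} need not extend to the left. *)
definition delay_solution ::
  "real \<Rightarrow> real \<Rightarrow> nat \<Rightarrow> (nat \<Rightarrow> real \<Rightarrow> real) \<Rightarrow>
   (nat \<Rightarrow> real \<Rightarrow> real) \<Rightarrow> (real \<Rightarrow> real) \<Rightarrow> bool" where
  "delay_solution T D n p \<tau> x \<longleftrightarrow>
     continuous_on {T - D..} x \<and>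
     C1_on x {T<..} \<and>
     (\<forall>t>T. \<exists>d. (x has_real_derivative d) (at t) \<and>
        d + (\<Sum>i=1..n. p i t * x (t - \<tau> i t)) = 0)"

(* c i is only defined from t0 + D on, hence its one-sided derivative at that point. *)
definition Pbar ::
  "real \<Rightarrow> real \<Rightarrow> (nat \<Rightarrow> real \<Rightarrow> real) \<Rightarrow>
   (nat \<Rightarrow> real \<Rightarrow> real) \<Rightarrow> (nat \<Rightarrow> real \<Rightarrow> real) \<Rightarrow>
   nat \<Rightarrow> real \<Rightarrow> real" where
  "Pbar t0 D P Q c i t =
     P i t - Q i (t - c i t) * (1 - vector_derivative (c i) (at t within {t0 + D..}))"

end

theory Submission
  imports Defs
begin

text \<open>
  Let \<open>x\<close> be an eventually positive solution of the neutral equation, and subtract from the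
  bracket the integrals of \<open>Q\<^sub>i(s) x(s - \<delta>\<^sub>i(s))\<close> over \<open>[t - c\<^sub>i(t), t]\<close>. Since
  \<open>c\<^sub>i(t) + \<delta>\<^sub>i(t - c\<^sub>i(t)) = \<tau>\<^sub>i(t)\<close>, the resulting \<open>z\<close> has derivative
  \<open>- \<Sum> Pbar\<^sub>i(t) x(t - \<tau>\<^sub>i(t)) \<le> 0\<close>. If \<open>z\<close> were not eventually positive, it would eventually
  stay below some \<open>-\<epsilon> < 0\<close>, and the condition on \<open>R\<close> and \<open>Q\<close> would force the maximum of \<open>x\<close> over
  windows of length \<open>2D\<close> to drop by \<open>\<epsilon>\<close> from each window to the next. So \<open>0 < z \<le> x\<close> eventually, and \<open>z\<close> is a
  positive solution of the inequality \<open>z' + \<Sum> P\<^sup>*\<^sub>i(t) z(t - \<tau>\<^sub>i(t)) \<le> 0\<close>. Such an inequality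
  yields a positive, hence nonoscillatory, solution of the delay equation.
\<close>

text \<open>Stated for integrable \<open>l\<close>, because it is applied to the limit of an
  iteration before that limit is known to be continuous.\<close>

lemma continuous_on_integral_atLeast:
  fixes l :: "real \<Rightarrow> real"
  assumes "\<And>b. l integrable_on {a..b}"
  shows "continuous_on {a..} (\<lambda>t. integral {a..t} l)"
  unfolding continuous_on_eq_continuous_within
proof
  fix t assume t: "t \<in> {a..}"
  have "continuous_on {a..t+1} (\<lambda>t. integral {a..t} l)"
    by (rule indefinite_integral_continuous_1[OF assms])
  then have "continuous (at t within {a..t+1}) (\<lambda>t. integral {a..t} l)"
    using t by (simp add: continuous_on_eq_continuous_within)
  moreover have "at t within {a..t+1} = at t within {a..}"
    by (rule at_within_nhd[where S="{..<t+1}"]) auto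
  ultimately show "continuous (at t within {a..}) (\<lambda>t. integral {a..t} l)"
    by simp
qed

lemma has_real_derivative_integral_atLeast:
  fixes l :: "real \<Rightarrow> real"
  assumes "continuous_on {a..} l" "a < t"
  shows "((\<lambda>t. integral {a..t} l) has_real_derivative l t) (at t)"
proof -
  have "((\<lambda>t. integral {a..t} l) has_real_derivative l t) (at t within {a..t+1})"
    using assms by (intro integral_has_real_derivative continuous_on_subset[OF assms(1)]) auto
  moreover have "at t within {a..t+1} = at t"
    using assms by (intro at_within_Icc_at) auto
  ultimately show ?thesis by simp
qed

lemma integrable_on_atLeast:
  fixes l :: "real \<Rightarrow> real"
  assumes "continuous_on {a..} l" "a \<le> b"
  shows "l integrable_on {b..d}"
  using assms by (intro integrable_continuous_interval continuous_on_subset[OF assms(1)]) auto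

lemma integral_diff_atLeast:
  fixes l :: "real \<Rightarrow> real"
  assumes "\<And>d. l integrable_on {a..d}" "a \<le> s" "s \<le> t"
  shows "integral {a..t} l - integral {a..s} l = integral {s..t} l"
  using Henstock_Kurzweil_Integration.integral_combine[OF assms(2,3) assms(1)] by simp

text \<open>
  The ansatz \<open>y(t) = exp (- \<integral>\<^sub>T\<^sup>t L)\<close>, with \<open>y = 1\<close> before \<open>T\<close>, turns the delay equation into the
  fixed point equation \<open>L = g L\<close> for a monotone operator \<open>g\<close>. The iteration from \<open>0\<close> increases and
  stays below the logarithmic derivative \<open>- z' / z\<close>. Iterating on \<open>y\<close> itself, from \<open>z\<close> downwards,
  could fail: when all delays vanish, \<open>z\<close> may decay faster than every positive solution.
\<close>
lemma positive_delay_solution_of_inequality: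
  fixes T D :: real and p \<tau> :: "nat \<Rightarrow> real \<Rightarrow> real" and z :: "real \<Rightarrow> real"
  assumes p_cont: "\<And>i. i \<in> {1..n} \<Longrightarrow> continuous_on {T..} (p i)"
    and \<tau>_cont: "\<And>i. i \<in> {1..n} \<Longrightarrow> continuous_on {T..} (\<tau> i)"
    and p_nonneg: "\<And>i t. i \<in> {1..n} \<Longrightarrow> T \<le> t \<Longrightarrow> 0 \<le> p i t"
    and \<tau>_bounds: "\<And>i t. i \<in> {1..n} \<Longrightarrow> T \<le> t \<Longrightarrow> 0 \<le> \<tau> i t \<and> \<tau> i t \<le> D"
    and z_pos: "\<And>t. T - D \<le> t \<Longrightarrow> 0 < z t"
    and z_anti: "\<And>s t. T - D \<le> s \<Longrightarrow> s \<le> t \<Longrightarrow> z t \<le> z s"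
    and z_cont: "continuous_on {T..} z"
    and z_ineq: "\<And>t. T < t \<Longrightarrow>
      \<exists>d. (z has_real_derivative d) (at t) \<and> d + (\<Sum>i=1..n. p i t * z (t - \<tau> i t)) \<le> 0"
    and "0 \<le> D"
  obtains y where "delay_solution T D n p \<tau> y" "\<And>t. 0 < y t"
proof -
  \<comment> \<open>Since \<open>y\<close> is constant before \<open>T\<close>, only the part of
    \<open>[t - \<tau> i t, t]\<close> after \<open>T\<close> contributes to
    \<open>y (t - \<tau> i t) / y t\<close>; \<open>m\<close> clips the delayed argument
    accordingly. Writing \<open>g\<close> with two integrals from the fixed point \<open>T\<close>
    makes its continuity and its limits immediate, while monotonicity is read off from the single
    integral in \<open>g_eq\<close>.\<close>
  define m where "m i t = max T (t - \<tau> i t)" for i t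
  define g where "g l t = (\<Sum>i=1..n. p i t * exp (integral {T..t} l - integral {T..m i t} l))"
    for l :: "real \<Rightarrow> real" and t
  have m_le: "T \<le> m i t" "m i t \<le> t" "t - \<tau> i t \<le> m i t" if "i \<in> {1..n}" "T \<le> t" for i t
    using \<tau>_bounds[OF that] that by (auto simp: m_def)
  have m_cont: "continuous_on {T..} (m i)" if "i \<in> {1..n}" for i
    unfolding m_def by (intro continuous_intros \<tau>_cont that)
  have g_eq: "g l t = (\<Sum>i=1..n. p i t * exp (integral {m i t..t} l))"
    if "\<And>b. l integrable_on {T..b}" "T \<le> t" for l t
    unfolding g_def using m_le that
    by (intro sum.cong refl) (simp add: integral_diff_atLeast)
  have g_cont: "continuous_on {T..} (g l)" if "\<And>b. l integrable_on {T..b}" for l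
  proof -
    have c: "continuous_on {T..} (\<lambda>t. integral {T..t} l)"
      by (rule continuous_on_integral_atLeast[OF that])
    have "continuous_on {T..} (\<lambda>t. integral {T..m i t} l)" if "i \<in> {1..n}" for i
      using m_le[OF that] by (intro continuous_on_compose2[OF c m_cont[OF that]]) auto
    then show ?thesis
      unfolding g_def using c p_cont by (intro continuous_intros) auto
  qed
  \<comment> \<open>\<open>B\<close> is the value of \<open>g\<close> at the logarithmic derivative
    of \<open>1 / z\<close>: there the exponential becomes \<open>z (m i t) / z t\<close>. It bounds
    all iterates and later serves as the dominating function.\<close>
  define B where "B t = (\<Sum>i=1..n. p i t * (z (m i t) / z t))" for t
  have z_pos': "0 < z t" if "T \<le> t" for t using z_pos that \<open>0 \<le> D\<close> by simp
  have z_m_cont: "continuous_on {T..} (\<lambda>t. z (m i t))" if "i \<in> {1..n}" for i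
    using m_le[OF that] by (intro continuous_on_compose2[OF z_cont m_cont[OF that]]) auto
  have B_cont: "continuous_on {T..} B"
    unfolding B_def using z_pos' by (intro continuous_intros p_cont z_m_cont z_cont) force+
  have B_nonneg: "0 \<le> B t" if "T \<le> t" for t
    unfolding B_def using that z_pos' m_le p_nonneg
    by (intro sum_nonneg mult_nonneg_nonneg divide_nonneg_nonneg) (auto intro: less_imp_le)
  define l where "l k = (g ^^ k) (\<lambda>_. 0)" for k
  have l_Suc: "l (Suc k) = g (l k)" for k by (simp add: l_def)
  have l_cont: "continuous_on {T..} (l k)" for k
  proof (induction k)
    case (Suc k)
    then show ?case unfolding l_Suc by (intro g_cont integrable_on_atLeast) auto
  qed (simp add: l_def)
  have l_int: "l k integrable_on {a..b}" if "T \<le> a" for k a b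
    by (rule integrable_on_atLeast[OF l_cont that])
  have l_Suc_eq: "l (Suc k) t = (\<Sum>i=1..n. p i t * exp (integral {m i t..t} (l k)))"
    if "T \<le> t" for k t
    unfolding l_Suc using that l_int by (intro g_eq) auto
  have l_nonneg: "0 \<le> l k t" if "T \<le> t" for k t
  proof (cases k)
    case (Suc j)
    then show ?thesis using that p_nonneg by (auto simp: l_Suc_eq intro!: sum_nonneg)
  qed (simp add: l_def)
  have l_mono: "l k t \<le> l (Suc k) t" if "T \<le> t" for k t
    using that
  proof (induction k arbitrary: t)
    case 0
    then show ?case using l_nonneg[of t "Suc 0"] by (simp add: l_def)
  next
    case (Suc k)
    have "integral {m i t..t} (l k) \<le> integral {m i t..t} (l (Suc k))" if "i \<in> {1..n}" for i
      using m_le[OF that Suc.prems] Suc.IH l_int by (intro integral_le) auto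
    then show ?case
      unfolding l_Suc_eq[OF Suc.prems] using p_nonneg Suc.prems
      by (intro sum_mono mult_left_mono) auto
  qed
  \<comment> \<open>The two bounds feed each other: the integral bound for \<open>l k\<close> gives
    \<open>l (Suc k) \<le> B\<close> (\<open>step\<close>), and integrating that against the
    inequality for \<open>z\<close> gives the integral bound for \<open>l (Suc k)\<close>.\<close>
  have l_bound: "integral {s..t} (l k) \<le> ln (z s) - ln (z t)"
    and l_Suc_le_B: "T \<le> t \<Longrightarrow> l (Suc k) t \<le> B t"
    if "T \<le> s" "s \<le> t" for k s t
  proof -
    have step: "l (Suc k) t \<le> B t"
      if "\<And>s t. T \<le> s \<Longrightarrow> s \<le> t \<Longrightarrow> integral {s..t} (l k) \<le> ln (z s) - ln (z t)" "T \<le> t" for k t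
      unfolding l_Suc_eq[OF that(2)] B_def
    proof (intro sum_mono mult_left_mono)
      fix i assume i: "i \<in> {1..n}"
      have "exp (integral {m i t..t} (l k)) \<le> exp (ln (z (m i t)) - ln (z t))"
        using that(1) m_le[OF i that(2)] by simp
      then show "exp (integral {m i t..t} (l k)) \<le> z (m i t) / z t"
        using z_pos' m_le[OF i that(2)] that(2) by (simp add: exp_diff)
      show "0 \<le> p i t" using p_nonneg i that by auto
    qed
    have bound: "integral {s..t} (l k) \<le> ln (z s) - ln (z t)" if "T \<le> s" "s \<le> t" for k s t
      using that
    proof (induction k arbitrary: s t)
      case 0
      have "z t \<le> z s" using z_anti 0 \<open>0 \<le> D\<close> by simp
      then show ?case using 0 z_pos' by (simp add: l_def)
    next
      case (Suc k)
      show ?case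
      proof (cases "s = t")
        case False
        then have "s < t" using Suc by simp
        \<comment> \<open>The claim is \<open>h t \<le> h s\<close>. The derivative
          \<open>l (Suc k) u + d / z u\<close> is at most \<open>B u + d / z u\<close>, and this is
          nonpositive: as \<open>z\<close> is nonincreasing, clipping the argument only lowers
          \<open>z\<close>, so \<open>B u * z u\<close> is at most the delayed sum in the inequality
          for \<open>z\<close>.\<close>
        define h where "h u = integral {T..u} (l (Suc k)) + ln (z u)" for u
        have "h t \<le> h s"
        proof (rule DERIV_nonpos_imp_decreasing_open[OF \<open>s \<le> t\<close>])
          fix u assume u: "s < u" "u < t"
          then have "T < u" using Suc by simp
          obtain d where d: "(z has_real_derivative d) (at u)"
            "d + (\<Sum>i=1..n. p i u * z (u - \<tau> i u)) \<le> 0"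
            using z_ineq[OF \<open>T < u\<close>] by blast
          have "(h has_real_derivative l (Suc k) u + d / z u) (at u)"
            unfolding h_def using z_pos'[of u] \<open>T < u\<close>
            by (auto intro!: derivative_eq_intros d
                has_real_derivative_integral_atLeast[OF l_cont] simp: field_simps)
          moreover have "B u \<le> (\<Sum>i=1..n. p i u * z (u - \<tau> i u)) / z u"
            unfolding B_def sum_divide_distrib
          proof (rule sum_mono)
            fix i assume i: "i \<in> {1..n}"
            have "z (m i u) \<le> z (u - \<tau> i u)"
              using m_le[OF i, of u] \<tau>_bounds[OF i, of u] \<open>T < u\<close> by (intro z_anti) auto
            then show "p i u * (z (m i u) / z u) \<le> p i u * z (u - \<tau> i u) / z u"
              using p_nonneg[OF i, of u] z_pos'[of u] \<open>T < u\<close>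
              by (auto intro!: divide_right_mono mult_left_mono)
          qed
          moreover have "(\<Sum>i=1..n. p i u * z (u - \<tau> i u)) / z u \<le> - d / z u"
            using d(2) z_pos'[of u] \<open>T < u\<close> by (intro divide_right_mono) auto
          moreover have "l (Suc k) u \<le> B u"
            using step[OF Suc.IH] \<open>T < u\<close> by simp
          ultimately show "\<exists>d. (h has_real_derivative d) (at u) \<and> d \<le> 0" by force
        next
          have "continuous_on {T..} h"
            unfolding h_def using z_pos' l_int
            by (intro continuous_intros z_cont continuous_on_integral_atLeast) force+
          then show "continuous_on {s..t} h"
            by (rule continuous_on_subset) (use Suc in auto)
        qed
        then show ?thesis
          using integral_diff_atLeast[of "l (Suc k)" T s t] l_int Suc.prems by (simp add: h_def)
      qed simp
    qed
    show "integral {s..t} (l k) \<le> ln (z s) - ln (z t)" using bound that .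
    show "l (Suc k) t \<le> B t" if "T \<le> t" using step[OF bound that] .
  qed
  have l_le_B: "l k t \<le> B t" if "T \<le> t" for k t
    using l_mono[OF that, of k] l_Suc_le_B[OF that order.refl that, of k] by simp
  define L where "L t = lim (\<lambda>k. l k t)" for t
  have L_lim: "(\<lambda>k. l k t) \<longlonglongrightarrow> L t" if "T \<le> t" for t
  proof -
    have "incseq (\<lambda>k. l k t)" using l_mono[OF that] by (rule incseq_SucI)
    then have "convergent (\<lambda>k. l k t)"
      using l_le_B[OF that] by (meson convergentI incseq_convergent)
    then show ?thesis unfolding L_def by (simp add: convergent_LIMSEQ_iff)
  qed
  have l_dom: "norm (l k t) \<le> B t" if "t \<in> {T..b}" for k t b
    using that l_nonneg[of t k] l_le_B[of t k] by simp
  have l_lim: "(\<lambda>k. l k t) \<longlonglongrightarrow> L t" if "t \<in> {T..b}" for t b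
    using that L_lim by simp
  \<comment> \<open>Pointwise convergence of the iterates passes to their integrals, which is all
    that \<open>g\<close> depends on.\<close>
  have dom: "L integrable_on {T..b}" "(\<lambda>k. integral {T..b} (l k)) \<longlonglongrightarrow> integral {T..b} L" for b
    by (rule dominated_convergence[OF l_int[OF order.refl] integrable_on_atLeast[OF B_cont order.refl]],
        erule l_dom, erule l_lim)+
  have L_fix: "L t = g L t" if "T \<le> t" for t
  proof (rule LIMSEQ_unique)
    show "(\<lambda>k. l (Suc k) t) \<longlonglongrightarrow> L t" using L_lim[OF that] by (rule LIMSEQ_Suc)
    show "(\<lambda>k. l (Suc k) t) \<longlonglongrightarrow> g L t"
      unfolding l_Suc g_def by (intro tendsto_intros dom)
  qed
  \<comment> \<open>Regularity comes from the fixed point equation: \<open>L\<close> is so far only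
    integrable, but \<open>g\<close> maps integrable functions to continuous ones.\<close>
  have L_cont: "continuous_on {T..} L"
    using g_cont[OF dom(1)] L_fix by (subst continuous_on_cong[OF refl, of _ _ "g L"]) auto
  define y where "y t = exp (- integral {T..max T t} L)" for t
  have y_deriv: "(y has_real_derivative - L t * y t) (at t)" if "T < t" for t
  proof -
    have "((\<lambda>t. exp (- integral {T..t} L)) has_real_derivative - L t * y t) (at t)"
      using that by (auto intro!: derivative_eq_intros
          has_real_derivative_integral_atLeast[OF L_cont] simp: y_def)
    then show ?thesis
      by (rule has_field_derivative_transform_within_open[where S="{T<..}"])
        (use that in \<open>auto simp: y_def\<close>)
  qed
  have y_cont: "continuous_on S y" for S
    unfolding y_def
    by (intro continuous_intros continuous_on_compose2[OF continuous_on_integral_atLeast[OF dom(1)]])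
      auto
  have "C1_on y {T<..}"
    unfolding C1_on_def
  proof (intro exI conjI ballI)
    show "(y has_real_derivative - L t * y t) (at t within {T<..})" if "t \<in> {T<..}" for t
      using y_deriv that by (auto intro: has_field_derivative_at_within)
    show "continuous_on {T<..} (\<lambda>t. - L t * y t)"
      by (intro continuous_intros y_cont continuous_on_subset[OF L_cont]) auto
  qed
  moreover have "- L t * y t + (\<Sum>i=1..n. p i t * y (t - \<tau> i t)) = 0" if "T < t" for t
  proof -
    \<comment> \<open>\<open>y\<close> and \<open>m\<close> clip at \<open>T\<close> in the same
      way, so \<open>y (t - \<tau> i t)\<close> is \<open>exp (- integral {T..m i t} L)\<close>; the
      integrals over \<open>{T..t}\<close> cancel in the product.\<close>
    have "L t * y t = (\<Sum>i=1..n. p i t * y (t - \<tau> i t))"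
      using L_fix[of t] that
      by (simp add: g_def y_def m_def sum_distrib_right mult.assoc flip: exp_add)
    then show ?thesis by simp
  qed
  ultimately have "delay_solution T D n p \<tau> y"
    unfolding delay_solution_def using y_cont y_deriv by blast
  then show thesis by (rule that) (simp add: y_def)
qed

text \<open>On the \<open>k\<close>-th consecutive window of length \<open>W\<close> the function is
  at most \<open>M - k * \<epsilon>\<close>, where \<open>M\<close> bounds it on the first one; for
  large \<open>k\<close> this contradicts positivity.\<close>

lemma no_positive_function_below_recent_sup:
  fixes x :: "real \<Rightarrow> real"
  assumes cont: "continuous_on {a..} x" and pos: "\<And>t. a \<le> t \<Longrightarrow> 0 < x t"
    and "0 \<le> W" "0 < \<epsilon>"
    and drop: "\<And>t M. a + W \<le> t \<Longrightarrow> (\<And>s. t - W \<le> s \<Longrightarrow> s \<le> t \<Longrightarrow> x s \<le> M) \<Longrightarrow> x t \<le> M - \<epsilon>"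
  shows False
proof -
  have attained: "\<exists>v\<in>{b..d}. \<forall>s\<in>{b..d}. x s \<le> x v" if "a \<le> b" "b \<le> d" for b d
    using that by (intro continuous_attains_sup continuous_on_subset[OF cont]) auto
  obtain M where M: "x s \<le> M" if "a \<le> s" "s \<le> a + W" for s
    using attained[of a "a + W"] \<open>0 \<le> W\<close> by force
  have step: "x t \<le> N - \<epsilon>"
    if "a \<le> b" "b + W \<le> t" "\<And>s. b \<le> s \<Longrightarrow> s \<le> b + W \<Longrightarrow> x s \<le> N" for b t N
  proof -
    \<comment> \<open>The window in \<open>drop\<close> reaches up to the current point, so a bound
      on the previous window alone does not suffice. At a maximum point \<open>v\<close> of the new
      stretch the recent values are at most \<open>max N (x v)\<close>; if this were
      \<open>x v\<close>, \<open>drop\<close> would give \<open>x v \<le> x v - \<epsilon>\<close>.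
      Hence \<open>N\<close> is the effective bound.\<close>
    obtain v where v: "b + W \<le> v" "v \<le> t" "\<And>s. b + W \<le> s \<Longrightarrow> s \<le> t \<Longrightarrow> x s \<le> x v"
    proof -
      have "a \<le> b + W" using \<open>a \<le> b\<close> \<open>0 \<le> W\<close> by simp
      then show thesis using attained[of "b + W" t] \<open>b + W \<le> t\<close> that by force
    qed
    have "x s \<le> max N (x v)" if "v - W \<le> s" "s \<le> v" for s
      using v(3)[of s] \<open>\<And>s. b \<le> s \<Longrightarrow> s \<le> b + W \<Longrightarrow> x s \<le> N\<close>[of s] that v(1,2)
      by (cases "s \<le> b + W") auto
    then have "x v \<le> max N (x v) - \<epsilon>" using v(1) that by (intro drop) auto
    then have "x v \<le> N - \<epsilon>" using \<open>0 < \<epsilon>\<close> by (auto simp: max_def split: if_splits)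
    then show ?thesis using v(3)[of t] that by simp
  qed
  have bound: "x t \<le> M - real k * \<epsilon>" if "a + real k * W \<le> t" "t \<le> a + real k * W + W" for k t
    using that
  proof (induction k arbitrary: t)
    case 0
    then show ?case using M by simp
  next
    case (Suc k)
    have "x t \<le> M - real k * \<epsilon> - \<epsilon>"
      using Suc \<open>0 \<le> W\<close> by (intro step[of "a + real k * W"]) (auto simp: algebra_simps)
    then show ?case by (simp add: algebra_simps)
  qed
  obtain k :: nat where "M < real k * \<epsilon>" using reals_Archimedean3[OF \<open>0 < \<epsilon>\<close>] by blast
  then show False
    using bound[of k "a + real k * W"] pos[of "a + real k * W"] \<open>0 \<le> W\<close> by simp
qed

lemma neutral_solution_uminus:
  assumes "neutral_solution t0 D Nr Np Nq R r P \<tau> Q \<delta> x"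
  shows "neutral_solution t0 D Nr Np Nq R r P \<tau> Q \<delta> (\<lambda>t. - x t)"
  unfolding neutral_solution_def
proof (intro conjI allI impI)
  show "continuous_on {t0 - D..} (\<lambda>t. - x t)"
    using assms by (auto simp: neutral_solution_def intro: continuous_on_minus)
  show "C1_on (\<lambda>t. - x t) {t0<..}"
  proof -
    obtain f where "\<And>t. t \<in> {t0<..} \<Longrightarrow> (x has_real_derivative f t) (at t within {t0<..})"
      "continuous_on {t0<..} f"
      using assms unfolding neutral_solution_def C1_on_def by blast
    then show ?thesis
      unfolding C1_on_def by (intro exI[of _ "\<lambda>t. - f t"]) (auto intro: DERIV_minus continuous_on_minus)
  qed
  fix t assume "t > t0"
  then obtain d where
    d: "((\<lambda>s. x s - (\<Sum>i=1..Nr. R i s * x (s - r i s))) has_real_derivative d) (at t)"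
    "d + (\<Sum>i=1..Np. P i t * x (t - \<tau> i t)) - (\<Sum>i=1..Nq. Q i t * x (t - \<delta> i t)) = 0"
    using assms unfolding neutral_solution_def by blast
  have "((\<lambda>s. - x s - (\<Sum>i=1..Nr. R i s * - x (s - r i s))) has_real_derivative - d) (at t)"
    using DERIV_minus[OF d(1)] by (simp add: sum_negf)
  moreover have "- d + (\<Sum>i=1..Np. P i t * - x (t - \<tau> i t)) - (\<Sum>i=1..Nq. Q i t * - x (t - \<delta> i t)) = 0"
    using d(2) by (simp add: sum_negf)
  ultimately show "\<exists>d. ((\<lambda>s. - x s - (\<Sum>i=1..Nr. R i s * - x (s - r i s))) has_real_derivative d) (at t)
    \<and> d + (\<Sum>i=1..Np. P i t * - x (t - \<tau> i t)) - (\<Sum>i=1..Nq. Q i t * - x (t - \<delta> i t)) = 0"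
    by blast
qed

theorem theorem3p1:
  fixes t0 D :: real
    and Nr Np Nq :: nat
    and R r P \<tau> Q \<delta> c Pstar cstar :: "nat \<Rightarrow> real \<Rightarrow> real"
  assumes "D > 0"
    and "Nq \<le> Np"
    and "\<forall>i\<in>{1..Nr}. continuous_on {t0..} (R i) \<and> continuous_on {t0..} (r i) \<and> C1_on (R i) {t0..}
           \<and> (\<forall>t\<ge>t0. 0 \<le> R i t \<and> 0 \<le> r i t \<and> r i t \<le> D)"
    and "\<forall>j\<in>{1..Np}. continuous_on {t0..} (P j) \<and> continuous_on {t0..} (\<tau> j) \<and> C1_on (\<tau> j) {t0..}
           \<and> (\<forall>t\<ge>t0. 0 \<le> P j t \<and> 0 \<le> \<tau> j t \<and> \<tau> j t \<le> D)"
    and "\<forall>k\<in>{1..Nq}. continuous_on {t0..} (Q k) \<and> continuous_on {t0..} (\<delta> k) \<and> C1_on (\<delta> k) {t0..}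
           \<and> (\<forall>t\<ge>t0. 0 \<le> Q k t \<and> 0 \<le> \<delta> k t \<and> \<delta> k t \<le> D)"
    and "\<forall>k\<in>{1..Nq}. \<forall>t>t0. \<delta> k t \<le> \<tau> k t \<and> deriv (\<delta> k) t < 1"
    and "\<forall>i\<in>{Nq<..Np}. \<forall>t\<ge>t0. Q i t = 0 \<and> \<delta> i t = 0"
    and "\<forall>i\<in>{1..Np}. c i differentiable_on {t0 + D..}
           \<and> (\<forall>t\<ge>t0 + D. c i t = \<tau> i t - \<delta> i (t - c i t) \<and> c i t \<in> {0..D})"
    and "\<forall>i\<in>{1..Np}. continuous_on {t0 + D..} (Pstar i)"
    and "\<forall>i\<in>{1..Np}. \<forall>t\<ge>t0 + D. 0 \<le> Pstar i t \<and> Pstar i t \<le> Pbar t0 D P Q c i t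
           \<and> c i t \<le> cstar i t"
    and "\<forall>T0>t0. \<exists>\<xi>>T0. \<xi> \<ge> t0 + D \<and> (\<Sum>i=1..Np. Pstar i \<xi>) > 0"
    and "\<forall>t\<ge>t0 + D. (\<Sum>i=1..Nr. R i t)
           + (\<Sum>i=1..Nq. integral ({t - cstar i t..t} \<inter> {t0..}) (Q i)) \<le> 1"
    and "\<forall>T\<ge>t0 + D. \<forall>x. delay_solution T D Np Pstar \<tau> x \<longrightarrow> oscillates x"
  shows "\<forall>x. neutral_solution t0 D Nr Np Nq R r P \<tau> Q \<delta> x \<longrightarrow> oscillates x"
proof -
  note R = assms(3) and P = assms(4) and Q = assms(5) and c = assms(8) and Pstar = assms(10)
  have no_positive: False
    if sol: "neutral_solution t0 D Nr Np Nq R r P \<tau> Q \<delta> x"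
      and "t0 \<le> T1" and pos: "\<And>t. T1 < t \<Longrightarrow> 0 < x t" for x T1
  proof -

    \<comment> \<open>The function \<open>z\<close>, its derivative and its monotonicity\<close>
    have x_cont: "continuous_on {t0 - D..} x" using sol by (simp add: neutral_solution_def)
    define q where "q i s = Q i s * x (s - \<delta> i s)" for i s
    define z where "z t = x t - (\<Sum>i=1..Nr. R i t * x (t - r i t))
      - (\<Sum>i=1..Nq. integral {t0..t} (q i) - integral {t0..t - c i t} (q i))" for t
    have q_cont: "continuous_on {t0..} (q i)" if "i \<in> {1..Nq}" for i
      unfolding q_def using Q that
      by (intro continuous_intros continuous_on_compose2[OF x_cont]) force+
    have c_bounds: "0 \<le> c i t" "c i t \<le> D" "t - c i t - \<delta> i (t - c i t) = t - \<tau> i t"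
      if "i \<in> {1..Np}" "t0 + D \<le> t" for i t
      using c that by fastforce+
    have z_deriv: "(z has_real_derivative - (\<Sum>i=1..Np. Pbar t0 D P Q c i t * x (t - \<tau> i t))) (at t)"
      if t: "t0 + D < t" for t
    proof -
      define v where "v i = vector_derivative (c i) (at t within {t0 + D..})" for i
      obtain d where
        d: "((\<lambda>s. x s - (\<Sum>i=1..Nr. R i s * x (s - r i s))) has_real_derivative d) (at t)"
        "d + (\<Sum>i=1..Np. P i t * x (t - \<tau> i t)) - (\<Sum>i=1..Nq. Q i t * x (t - \<delta> i t)) = 0"
      proof -
        have "t0 < t" using t \<open>D > 0\<close> by simp
        then show thesis using sol that unfolding neutral_solution_def by blast
      qed
      have F: "((\<lambda>t. integral {t0..t} (q i) - integral {t0..t - c i t} (q i)) has_real_derivative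
          Q i t * x (t - \<delta> i t) - Q i (t - c i t) * (1 - v i) * x (t - \<tau> i t)) (at t)"
        if i: "i \<in> {1..Nq}" for i
      proof -
        have i': "i \<in> {1..Np}" using i \<open>Nq \<le> Np\<close> by simp
        \<comment> \<open>\<open>Pbar\<close> uses the derivative within \<open>{t0 + D..}\<close>;
          as \<open>t\<close> is interior to that set, it is the two-sided derivative required by
          the chain rule.\<close>
        have "(c i has_vector_derivative v i) (at t within {t0 + D..})"
          unfolding v_def using c i' t
          by (auto simp: differentiable_on_def simp flip: vector_derivative_works)
        then have c': "(c i has_real_derivative v i) (at t)"
          using at_within_interior[of t "{t0 + D..}"] t
          by (simp add: has_real_derivative_iff_has_vector_derivative)
        have "t0 < t - c i t" using c_bounds(1,2)[OF i', of t] t by simp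
        then have "((\<lambda>u. integral {t0..u} (q i)) has_real_derivative q i (t - c i t)) (at (t - c i t))"
          by (intro has_real_derivative_integral_atLeast q_cont i)
        then have "((\<lambda>t. integral {t0..t - c i t} (q i)) has_real_derivative
            q i (t - c i t) * (1 - v i)) (at t)"
          by (rule DERIV_chain2) (auto intro!: derivative_eq_intros c')
        moreover have "((\<lambda>t. integral {t0..t} (q i)) has_real_derivative q i t) (at t)"
          using t \<open>D > 0\<close> by (intro has_real_derivative_integral_atLeast q_cont i) auto
        ultimately show ?thesis
          using DERIV_diff c_bounds(3)[OF i', of t] t by (fastforce simp: q_def mult_ac)
      qed
      have "(z has_real_derivative d - (\<Sum>i=1..Nq. Q i t * x (t - \<delta> i t)
          - Q i (t - c i t) * (1 - v i) * x (t - \<tau> i t))) (at t)"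
        unfolding z_def by (intro DERIV_diff d(1) DERIV_sum F)
      \<comment> \<open>Beyond \<open>Nq\<close> the \<open>Q i\<close> vanish on
        \<open>{t0..}\<close>, where \<open>t - c i t\<close> lies. The sum can thus run up to
        \<open>Np\<close> and merge with the \<open>P i\<close> into \<open>Pbar\<close>.\<close>
      moreover have "(\<Sum>i=1..Nq. Q i (t - c i t) * (1 - v i) * x (t - \<tau> i t))
          = (\<Sum>i=1..Np. Q i (t - c i t) * (1 - v i) * x (t - \<tau> i t))"
      proof (rule sum.mono_neutral_left)
        have "Q i (t - c i t) = 0" if "i \<in> {Nq<..Np}" for i
          using assms(7) c_bounds(1,2)[of i t] t that by auto
        then show "\<forall>i\<in>{1..Np} - {1..Nq}. Q i (t - c i t) * (1 - v i) * x (t - \<tau> i t) = 0"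
          by auto
      qed (use \<open>Nq \<le> Np\<close> in auto)
      moreover have "(\<Sum>i=1..Np. Pbar t0 D P Q c i t * x (t - \<tau> i t))
          = (\<Sum>i=1..Np. P i t * x (t - \<tau> i t))
            - (\<Sum>i=1..Np. Q i (t - c i t) * (1 - v i) * x (t - \<tau> i t))"
        by (simp only: Pbar_def v_def left_diff_distrib sum_subtractf)
      moreover have "d = (\<Sum>i=1..Nq. Q i t * x (t - \<delta> i t)) - (\<Sum>i=1..Np. P i t * x (t - \<tau> i t))"
        using d(2) by linarith
      ultimately show ?thesis by (simp add: sum_subtractf)
    qed
    \<comment> \<open>One \<open>D\<close> accounts for \<open>c i\<close>, the other for
      \<open>\<delta> i\<close>: for \<open>t > T2\<close> all values of \<open>x\<close> entering
      the integrals in \<open>z t\<close> are taken after \<open>T1\<close>, hence positive.\<close>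
    define T2 where "T2 = T1 + 2 * D"
    have T2: "t0 + D < t" "T1 + D < t" if "T2 < t" for t
      using that \<open>D > 0\<close> \<open>t0 \<le> T1\<close> by (auto simp: T2_def)
    have delayed_pos: "0 < x (t - \<tau> i t)" if "i \<in> {1..Np}" "T2 < t" for i t
    proof -
      have "\<tau> i t \<le> D" using P that T2[of t] \<open>D > 0\<close> by auto
      then show ?thesis using T2[of t] that by (intro pos) auto
    qed
    have Pstar_le: "(\<Sum>i=1..Np. Pstar i t * x (t - \<tau> i t))
        \<le> (\<Sum>i=1..Np. Pbar t0 D P Q c i t * x (t - \<tau> i t))" if "T2 < t" for t
      using Pstar delayed_pos T2[OF that] that
      by (intro sum_mono mult_right_mono) (auto intro: less_imp_le)
    have Pstar_nonneg: "0 \<le> (\<Sum>i=1..Np. Pstar i t * x (t - \<tau> i t))" if "T2 < t" for t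
      using Pstar delayed_pos T2[OF that] that
      by (intro sum_nonneg mult_nonneg_nonneg) (auto intro: less_imp_le)
    have z_anti: "z t \<le> z s" if "T2 < s" "s \<le> t" for s t
    proof (rule DERIV_nonpos_imp_nonincreasing[OF that(2)])
      fix u assume "s \<le> u" "u \<le> t"
      then show "\<exists>d. (z has_real_derivative d) (at u) \<and> d \<le> 0"
        using z_deriv[of u] Pstar_le[of u] Pstar_nonneg[of u] T2[of u] that by force
    qed

    \<comment> \<open>Bounds for \<open>x\<close> in terms of \<open>z\<close>\<close>
    have z_eq: "x t = z t + (\<Sum>i=1..Nr. R i t * x (t - r i t)) + (\<Sum>i=1..Nq. integral {t - c i t..t} (q i))"
      if t: "t0 + D \<le> t" for t
    proof -
      have "integral {t0..t} (q i) - integral {t0..t - c i t} (q i) = integral {t - c i t..t} (q i)"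
        if "i \<in> {1..Nq}" for i
        using that t c_bounds(1,2)[of i t] \<open>Nq \<le> Np\<close>
        by (intro integral_diff_atLeast integrable_on_atLeast[OF q_cont]) auto
      then show ?thesis by (simp add: z_def)
    qed
    have z_le_x: "z t \<le> x t" if t: "T2 < t" for t
    proof -
      have "0 \<le> R i t * x (t - r i t)" if "i \<in> {1..Nr}" for i
      proof -
        have "0 \<le> R i t" "r i t \<le> D" using R that T2[OF t] \<open>D > 0\<close> by auto
        then show ?thesis using T2[OF t] by (intro mult_nonneg_nonneg less_imp_le[OF pos]) auto
      qed
      moreover have "0 \<le> integral {t - c i t..t} (q i)" if i: "i \<in> {1..Nq}" for i
      proof (rule integral_nonneg)
        have c': "0 \<le> c i t" "c i t \<le> D" using c_bounds[of i t] i \<open>Nq \<le> Np\<close> T2[OF t] by auto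
        then show "q i integrable_on {t - c i t..t}"
          using T2[OF t] by (intro integrable_on_atLeast[OF q_cont[OF i]]) auto
        fix s assume s: "s \<in> {t - c i t..t}"
        then have "0 \<le> Q i s" "\<delta> i s \<le> D" using Q i c' T2[OF t] by auto
        then show "0 \<le> q i s"
          unfolding q_def using c' t s
          by (intro mult_nonneg_nonneg less_imp_le[OF pos]) (auto simp: T2_def)
      qed
      ultimately show ?thesis
        using z_eq[of t] T2[OF t]
          sum_nonneg[of "{1..Nr}" "\<lambda>i. R i t * x (t - r i t)"]
          sum_nonneg[of "{1..Nq}" "\<lambda>i. integral {t - c i t..t} (q i)"] by simp
    qed
    \<comment> \<open>The length \<open>2 * D\<close> covers \<open>r i\<close> as well as
      \<open>c i\<close> followed by \<open>\<delta> i\<close>. Replacing every delayed value by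
      \<open>M\<close> leaves the factor that the condition on \<open>R\<close> and \<open>Q\<close>
      bounds by 1.\<close>
    have x_le: "x t \<le> z t + M"
      if t: "t0 + D \<le> t" and M: "\<And>s. t - 2 * D \<le> s \<Longrightarrow> s \<le> t \<Longrightarrow> x s \<le> M" and "0 \<le> M" for t M
    proof -
      have "R i t * x (t - r i t) \<le> R i t * M" if "i \<in> {1..Nr}" for i
      proof -
        have "0 \<le> R i t" "0 \<le> r i t" "r i t \<le> D" using R that t \<open>D > 0\<close> by auto
        then show ?thesis using \<open>D > 0\<close> by (intro mult_left_mono M) auto
      qed
      moreover have "integral {t - c i t..t} (q i) \<le> integral ({t - cstar i t..t} \<inter> {t0..}) (Q i) * M"
        if i: "i \<in> {1..Nq}" for i
      proof -
        have c': "0 \<le> c i t" "c i t \<le> D" "c i t \<le> cstar i t"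
          using c_bounds[of i t] Pstar i \<open>Nq \<le> Np\<close> t by auto
        have Q_int: "Q i integrable_on {u..t}" if "t0 \<le> u" for u
          using Q i that by (intro integrable_on_atLeast[of t0]) auto
        have q_le: "q i s \<le> Q i s * M" if "s \<in> {t - c i t..t}" for s
        proof -
          have "0 \<le> Q i s" "0 \<le> \<delta> i s" "\<delta> i s \<le> D" using Q i c' t that by auto
          then show ?thesis
            unfolding q_def using that c' by (intro mult_left_mono M) auto
        qed
        have "integral {t - c i t..t} (q i) \<le> integral {t - c i t..t} (\<lambda>s. Q i s * M)"
          using c' t q_le
          by (intro integral_le integrable_on_mult_left Q_int integrable_on_atLeast[OF q_cont[OF i]]) auto
        also have "\<dots> = integral {t - c i t..t} (Q i) * M" by simp
        \<comment> \<open>Since \<open>Q i\<close> is nonnegative, lengthening the interval from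
          \<open>c i t\<close> to \<open>cstar i t\<close> only increases the integral. The left end
          is cut at \<open>t0\<close>, because \<open>cstar i t\<close> may reach back beyond the
          domain of the assumptions on \<open>Q i\<close>.\<close>
        also have "\<dots> \<le> integral {max (t - cstar i t) t0..t} (Q i) * M"
          using c' t Q i \<open>0 \<le> M\<close>
          by (intro mult_right_mono integral_subset_le Q_int) auto
        also have "{max (t - cstar i t) t0..t} = {t - cstar i t..t} \<inter> {t0..}" by auto
        finally show ?thesis .
      qed
      ultimately have "x t \<le> z t + (\<Sum>i=1..Nr. R i t * M)
          + (\<Sum>i=1..Nq. integral ({t - cstar i t..t} \<inter> {t0..}) (Q i) * M)"
        unfolding z_eq[OF t] by (intro add_mono sum_mono) auto
      also have "\<dots> = z t + ((\<Sum>i=1..Nr. R i t)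
          + (\<Sum>i=1..Nq. integral ({t - cstar i t..t} \<inter> {t0..}) (Q i))) * M"
        by (simp add: sum_distrib_right distrib_right)
      also have "\<dots> \<le> z t + 1 * M"
        using assms(12) t \<open>0 \<le> M\<close> by (intro add_left_mono mult_right_mono) auto
      finally show ?thesis by simp
    qed

    \<comment> \<open>Positivity of \<open>z\<close>\<close>
    have z_pos: "0 < z t" if t: "T2 < t" for t
    proof (rule ccontr)
      assume "\<not> 0 < z t"
      \<comment> \<open>So far \<open>z\<close> is only known to be nonpositive at \<open>t\<close>
        and nonincreasing afterwards, whereas a fixed drop needs a strictly negative value. At
        \<open>\<xi>\<close> the derivative of \<open>z\<close> is strictly negative, so
        \<open>z\<close> is below \<open>z t\<close> at some point \<open>t2\<close> just after
        \<open>\<xi>\<close>.\<close>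
      obtain \<xi> where \<xi>: "t < \<xi>" "(\<Sum>i=1..Np. Pstar i \<xi>) > 0"
        using assms(11) T2[OF t] \<open>D > 0\<close> by (metis add_strict_increasing less_add_same_cancel1 less_trans)
      then have "T2 < \<xi>" using t by simp
      have "(\<Sum>i=1..Np. Pstar i \<xi> * x (\<xi> - \<tau> i \<xi>)) \<noteq> 0"
      proof
        assume "(\<Sum>i=1..Np. Pstar i \<xi> * x (\<xi> - \<tau> i \<xi>)) = 0"
        then have "\<forall>i\<in>{1..Np}. Pstar i \<xi> * x (\<xi> - \<tau> i \<xi>) = 0"
          using Pstar delayed_pos[OF _ \<open>T2 < \<xi>\<close>] T2[OF \<open>T2 < \<xi>\<close>]
          by (subst (asm) sum_nonneg_eq_0_iff) (auto intro!: mult_nonneg_nonneg intro: less_imp_le)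
        then have "\<forall>i\<in>{1..Np}. Pstar i \<xi> = 0"
          using delayed_pos[OF _ \<open>T2 < \<xi>\<close>] by fastforce
        then show False using \<xi>(2) by simp
      qed
      then have "- (\<Sum>i=1..Np. Pbar t0 D P Q c i \<xi> * x (\<xi> - \<tau> i \<xi>)) < 0"
        using Pstar_le[OF \<open>T2 < \<xi>\<close>] Pstar_nonneg[OF \<open>T2 < \<xi>\<close>] by linarith
      then obtain h where h: "h > 0" "\<forall>k>0. k < h \<longrightarrow> z (\<xi> + k) < z \<xi>"
        using DERIV_neg_dec_right[OF z_deriv] T2[OF \<open>T2 < \<xi>\<close>] by blast
      define t2 where "t2 = \<xi> + h / 2"
      have "z t2 < z \<xi>" using h by (simp add: t2_def)
      moreover have "z \<xi> \<le> z t" using z_anti t \<xi> by simp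
      ultimately have "z t2 < 0" using \<open>\<not> 0 < z t\<close> by simp
      have "T2 < t2" using \<open>T2 < \<xi>\<close> h by (simp add: t2_def)
      show False
      \<comment> \<open>After \<open>t2\<close> the function \<open>z\<close> stays at or below
        \<open>z t2\<close>, so \<open>x_le\<close> yields the drop with
        \<open>\<epsilon> = - z t2\<close>.\<close>
      proof (rule no_positive_function_below_recent_sup[of t2 x "2 * D" "- z t2"])
        show "continuous_on {t2..} x"
          by (rule continuous_on_subset[OF x_cont]) (use T2[OF \<open>T2 < t2\<close>] \<open>D > 0\<close> in auto)
        show pos': "0 < x s" if "t2 \<le> s" for s
          using that T2[OF \<open>T2 < t2\<close>] \<open>D > 0\<close> by (intro pos) auto
        fix s M assume s: "t2 + 2 * D \<le> s" and M: "\<And>u. s - 2 * D \<le> u \<Longrightarrow> u \<le> s \<Longrightarrow> x u \<le> M"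
        have "0 \<le> M" using M[of s] pos'[of s] s \<open>D > 0\<close> by simp
        then have "x s \<le> z s + M"
          using s T2[OF \<open>T2 < t2\<close>] \<open>D > 0\<close> by (intro x_le M) auto
        moreover have "z s \<le> z t2" using z_anti[OF \<open>T2 < t2\<close>, of s] s \<open>D > 0\<close> by simp
        ultimately show "x s \<le> M - - z t2" by simp
      qed (use \<open>D > 0\<close> \<open>z t2 < 0\<close> in auto)
    qed

    \<comment> \<open>Passage to the delay equation\<close>
    define T where "T = T2 + D + 1"
    \<comment> \<open>The shift by \<open>D + 1\<close> puts the whole initial segment
      \<open>{T - D..T}\<close> strictly after \<open>T2\<close>, where \<open>z\<close> is
      positive, nonincreasing and at most \<open>x\<close>.\<close>
    have T: "T2 < T" "T2 < T - D" "t0 + D \<le> T" using T2[of T] \<open>D > 0\<close> by (auto simp: T_def)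
    obtain y where y: "delay_solution T D Np Pstar \<tau> y" "\<And>t. 0 < y t"
    proof (rule positive_delay_solution_of_inequality[of Np T Pstar \<tau> D z])
      show "continuous_on {T..} (Pstar i)" if "i \<in> {1..Np}" for i
        by (rule continuous_on_subset[of "{t0 + D..}"]) (use assms(9) that T in auto)
      show "continuous_on {T..} (\<tau> i)" if "i \<in> {1..Np}" for i
        by (rule continuous_on_subset[of "{t0..}"]) (use P that T \<open>D > 0\<close> in auto)
      show "0 \<le> Pstar i t" if "i \<in> {1..Np}" "T \<le> t" for i t
        using Pstar that T by auto
      show \<tau>_bounds: "0 \<le> \<tau> i t \<and> \<tau> i t \<le> D" if "i \<in> {1..Np}" "T \<le> t" for i t
        using P that T \<open>D > 0\<close> by auto
      show "0 < z t" if "T - D \<le> t" for t using z_pos T that by simp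
      show "z t \<le> z s" if "T - D \<le> s" "s \<le> t" for s t using z_anti T that by simp
      show "continuous_on {T..} z"
      proof (rule DERIV_continuous_on)
        fix t assume "t \<in> {T..}"
        then have "t0 + D < t" using T2(1)[of t] T by simp
        then show "(z has_real_derivative - (\<Sum>i=1..Np. Pbar t0 D P Q c i t * x (t - \<tau> i t)))
            (at t within {T..})"
          by (rule has_field_derivative_at_within[OF z_deriv])
      qed
      show "\<exists>d. (z has_real_derivative d) (at t) \<and> d + (\<Sum>i=1..Np. Pstar i t * z (t - \<tau> i t)) \<le> 0"
        if "T < t" for t
      proof (intro exI conjI)
        show "(z has_real_derivative - (\<Sum>i=1..Np. Pbar t0 D P Q c i t * x (t - \<tau> i t))) (at t)"
          using z_deriv T2[of t] T that by simp
        have "Pstar i t * z (t - \<tau> i t) \<le> Pstar i t * x (t - \<tau> i t)" if "i \<in> {1..Np}" for i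
          using \<tau>_bounds[OF that, of t] Pstar that \<open>T < t\<close> T
          by (intro mult_left_mono z_le_x) auto
        then have "(\<Sum>i=1..Np. Pstar i t * z (t - \<tau> i t)) \<le> (\<Sum>i=1..Np. Pstar i t * x (t - \<tau> i t))"
          by (rule sum_mono)
        then show "- (\<Sum>i=1..Np. Pbar t0 D P Q c i t * x (t - \<tau> i t))
            + (\<Sum>i=1..Np. Pstar i t * z (t - \<tau> i t)) \<le> 0"
          using Pstar_le[of t] T that by simp
      qed
    qed (use \<open>D > 0\<close> in auto)
    then have "oscillates y" using assms(13) T by blast
    then obtain t where "y t = 0" unfolding oscillates_def by blast
    then show False using y(2)[of t] by simp
  qed

  \<comment> \<open>Reduction to eventually positive solutions\<close>
  show ?thesis
  proof (intro allI impI)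
    fix x assume sol: "neutral_solution t0 D Nr Np Nq R r P \<tau> Q \<delta> x"
    show "oscillates x"
    proof (rule ccontr)
      assume "\<not> oscillates x"
      then obtain T0 where T0: "\<And>t. T0 < t \<Longrightarrow> x t \<noteq> 0" unfolding oscillates_def by blast
      define T1 where "T1 = max t0 T0"
      have "continuous_on {T1<..} x"
        using sol \<open>D > 0\<close> unfolding neutral_solution_def T1_def
        by (auto elim!: continuous_on_subset)
      \<comment> \<open>A connected image that avoids 0 lies on one side of it, so \<open>x\<close>
        has constant sign after \<open>T1\<close>. By linearity the negative case is the positive
        one for \<open>-x\<close>.\<close>
      then have "connected (x ` {T1<..})" by (intro connected_continuous_image) auto
      moreover have "0 \<notin> x ` {T1<..}" using T0 by (force simp: T1_def)
      ultimately consider "\<And>t. T1 < t \<Longrightarrow> 0 < x t" | "\<And>t. T1 < t \<Longrightarrow> 0 < - x t"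
        by (smt (verit) connectedD_interval greaterThan_iff image_eqI)
      then show False
      proof cases
        case 1
        then show ?thesis using no_positive[OF sol, of T1] by (simp add: T1_def)
      next
        case 2
        then show ?thesis
          using no_positive[OF neutral_solution_uminus[OF sol], of T1] by (simp add: T1_def)
      qed
    qed
  qed
qed

end
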